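(* For every integer $n\ge1$, $$\left[ a^{n-1} b^n c^n d^n q^{\binom n2} \right] 2^n(abcd;q)_n \mu_n(a,b,c,d;q) = -\operatorname{Cat}\left(\frac {n+1}2\right),$$ $$\left[ a^{n-1} b^{n-1} c^n d^n q^{\binom n2} \right] 2^n(abcd;q)_n \mu_n(a,b,c,d;q) = \operatorname{Cat}\left(\frac {n+2}2\right) - \operatorname{Cat}\left(\frac {n}2\right),$$ where $\operatorname{Cat}(x) =\frac{1}{x+1}\binom{2x}{x}$ if $x$ is a nonnegative integer, and $\operatorname{Cat}(x)=0$ otherwise.
   Context: Let $a,b,c,d,q$ be indeterminates (generic parameters). The monic Askey-Wilson polynomials $P_n(x)=P_n(x;a,b,c,d;q)$ are defined by $P_{-1}=0$, $P_0=1$, $P_{n+1}=(x-b_n)P_n-\lambda_nP_{n-1}$, with $b_n=\frac12(a+a^{-1}-(A_n+C_n))$, $\lambda_n=\frac14A_{n-1}C_n$, where $$A_n=\frac{(1-abq^n)(1-acq^n)(1-adq^n)(1-abcdq^{n-1})}{a(1-abcdq^{2n-1})(1-abcdq^{2n})},\quad C_n=\frac{a(1-q^n)(1-bcq^{n-1})(1-bdq^{n-1})(1-cdq^{n-1})}{(1-abcdq^{2n-2})(1-abcdq^{2n-1})}$$ (for $n=0$ the common factor $1-abcdq^{-1}$ in $A_0$ is cancelled, and $C_0=0$). The moment $\mu_n(a,b,c,d;q)=L(x^n)$, where $L$ is the unique linear functional on polynomials in $x$ with $L(1)=1$ and $L(P_n)=0$ for all $n\ge1$ (so that $L(P_mP_n)=0$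 for $m\neq n$). It is a rational function of $a,b,c,d,q$, and $2^n(abcd;q)_n\mu_n(a,b,c,d;q)$ is a polynomial in $a,b,c,d,q$ with integer coefficients. Here $(x;q)_m=\prod_{i=0}^{m-1}(1-xq^i)$, and $[M]F$ denotes the coefficient of the monomial $M$ in the polynomial $F$. *)

theory Defs
  imports "HOL-Computational_Algebra.Computational_Algebra"
begin

definition q_pochhammer :: "'a::comm_ring_1 \<Rightarrow> 'a \<Rightarrow> nat \<Rightarrow> 'a" where
  "q_pochhammer x q m = (\<Prod>i<m. 1 - x * q ^ i)"

definition Cat :: "rat \<Rightarrow> rat" where
  "Cat x = (if x \<in> \<nat> then 1 / (x + 1) * of_nat (nat \<lfloor>2 * x\<rfloor> choose nat \<lfloor>x\<rfloor>) else 0)"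


text \<open>The case \<open>n = 0\<close> of \<open>A\<close> is the general formula after cancelling the
  common factor \<open>1 - a b c d / q\<close>; the guards also keep the subtractions of exponents
  from truncating.\<close>

definition aw_A :: "'a::field \<Rightarrow> 'a \<Rightarrow> 'a \<Rightarrow> 'a \<Rightarrow> 'a \<Rightarrow> nat \<Rightarrow> 'a" where
  "aw_A a b c d q n =
     (if n = 0 then (1 - a*b) * (1 - a*c) * (1 - a*d) / (a * (1 - a*b*c*d))
      else (1 - a*b*q^n) * (1 - a*c*q^n) * (1 - a*d*q^n) * (1 - a*b*c*d*q^(n-1)) /
           (a * (1 - a*b*c*d*q^(2*n-1)) * (1 - a*b*c*d*q^(2*n))))"

definition aw_C :: "'a::field \<Rightarrow> 'a \<Rightarrow> 'a \<Rightarrow> 'a \<Rightarrow> 'a \<Rightarrow> nat \<Rightarrow> 'a" where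
  "aw_C a b c d q n =
     (if n = 0 then 0
      else a * (1 - q^n) * (1 - b*c*q^(n-1)) * (1 - b*d*q^(n-1)) * (1 - c*d*q^(n-1)) /
           ((1 - a*b*c*d*q^(2*n-2)) * (1 - a*b*c*d*q^(2*n-1))))"

definition aw_b :: "'a::field \<Rightarrow> 'a \<Rightarrow> 'a \<Rightarrow> 'a \<Rightarrow> 'a \<Rightarrow> nat \<Rightarrow> 'a" where
  "aw_b a b c d q n = 1/2 * (a + inverse a - (aw_A a b c d q n + aw_C a b c d q n))"

text \<open>Only used for \<open>n \<ge> 1\<close>.\<close>

definition aw_lambda :: "'a::field \<Rightarrow> 'a \<Rightarrow> 'a \<Rightarrow> 'a \<Rightarrow> 'a \<Rightarrow> nat \<Rightarrow> 'a" where
  "aw_lambda a b c d q n = 1/4 * aw_A a b c d q (n-1) * aw_C a b c d q n"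

text \<open>The second equation incorporates \<open>P\<^sub>-\<^sub>1 = 0\<close>.\<close>

fun aw_poly :: "'a::field \<Rightarrow> 'a \<Rightarrow> 'a \<Rightarrow> 'a \<Rightarrow> 'a \<Rightarrow> nat \<Rightarrow> 'a poly" where
  "aw_poly a b c d q 0 = 1"
| "aw_poly a b c d q (Suc 0) = [:- aw_b a b c d q 0, 1:]"
| "aw_poly a b c d q (Suc (Suc n)) =
     [:- aw_b a b c d q (Suc n), 1:] * aw_poly a b c d q (Suc n)
     - smult (aw_lambda a b c d q (Suc n)) (aw_poly a b c d q n)"

definition is_aw_functional ::
    "'a::field \<Rightarrow> 'a \<Rightarrow> 'a \<Rightarrow> 'a \<Rightarrow> 'a \<Rightarrow> ('a poly \<Rightarrow> 'a) \<Rightarrow> bool" where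
  "is_aw_functional a b c d q L \<longleftrightarrow>
     Vector_Spaces.linear smult (*) L \<and> L 1 = 1 \<and> (\<forall>n\<ge>1. L (aw_poly a b c d q n) = 0)"

text \<open>Such a functional exists and is unique, see \<open>ex1_aw_functional\<close> below.\<close>

definition aw_functional :: "'a::field \<Rightarrow> 'a \<Rightarrow> 'a \<Rightarrow> 'a \<Rightarrow> 'a \<Rightarrow> 'a poly \<Rightarrow> 'a" where
  "aw_functional a b c d q = (THE L. is_aw_functional a b c d q L)"

definition aw_moment :: "'a::field \<Rightarrow> 'a \<Rightarrow> 'a \<Rightarrow> 'a \<Rightarrow> 'a \<Rightarrow> nat \<Rightarrow> 'a" where
  "aw_moment a b c d q n = aw_functional a b c d q (monom 1 n)"

lemma vector_space_smult: "vector_space (smult :: 'a::field \<Rightarrow> 'a poly \<Rightarrow> 'a poly)"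
  by unfold_locales (simp_all add: smult_add_right smult_add_left)

lemma linear_smult_iff:
  fixes L :: "'a::field poly \<Rightarrow> 'a"
  shows "Vector_Spaces.linear smult (*) L \<longleftrightarrow>
           (\<forall>p r. L (p + r) = L p + L r) \<and> (\<forall>k p. L (smult k p) = k * L p)"
proof -
  have "vector_space ((*) :: 'a \<Rightarrow> 'a \<Rightarrow> 'a)"
    by unfold_locales (simp_all add: algebra_simps)
  then show ?thesis
    using vector_space_smult
    by (auto simp: Vector_Spaces.linear_iff)
qed

lemma aw_poly_monic: "degree (aw_poly a b c d q n) = n \<and> lead_coeff (aw_poly a b c d q n) = 1"
proof (induction n rule: less_induct)
  case (less n)
  show ?case
  proof (cases "n \<le> 1")
    case True
    then show ?thesis by (cases n) auto
  next
    case False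
    then obtain m where n: "n = Suc (Suc m)"
      by (metis One_nat_def Suc_le_mono le0 not0_implies_Suc)
    let ?P = "aw_poly a b c d q"
    let ?f = "[:- aw_b a b c d q (Suc m), 1:] * ?P (Suc m)"
    let ?g = "smult (aw_lambda a b c d q (Suc m)) (?P m)"
    have m: "degree (?P m) = m" and s: "degree (?P (Suc m)) = Suc m" "lead_coeff (?P (Suc m)) = 1"
      using less.IH[of m] less.IH[of "Suc m"] n by auto
    from s have nz: "?P (Suc m) \<noteq> 0" by auto
    have df: "degree ?f = n"
      using nz s(1) n by (subst degree_mult_eq) auto
    have lf: "lead_coeff ?f = 1"
      using s(2) by (simp only: lead_coeff_mult) simp
    have dg: "degree (- ?g) < degree ?f"
      using degree_smult_le[of "aw_lambda a b c d q (Suc m)" "?P m"] m df n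
      by (simp del: degree_smult_eq)
    have eq: "?P n = - ?g + ?f" using n by simp
    show ?thesis
      unfolding eq using degree_add_eq_right[OF dg] lead_coeff_add_le[OF dg] df lf by simp
  qed
qed

lemma degree_aw_poly: "degree (aw_poly a b c d q n) = n"
  and coeff_aw_poly: "coeff (aw_poly a b c d q n) n = 1"
  using aw_poly_monic[of a b c d q n] by auto

fun aw_moment_rec :: "(nat \<Rightarrow> 'a::field poly) \<Rightarrow> nat \<Rightarrow> 'a" where
  "aw_moment_rec P n = (if n = 0 then 1 else - (\<Sum>k<n. coeff (P n) k * aw_moment_rec P k))"

declare aw_moment_rec.simps [simp del]

lemma ex1_aw_functional: "\<exists>!L. is_aw_functional a b c d q L"
proof (rule ex_ex1I)
  let ?P = "aw_poly a b c d q"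
  let ?m = "aw_moment_rec ?P"
  define L where "L p = (\<Sum>k\<le>degree p. coeff p k * ?m k)" for p
  have L_eq: "L p = (\<Sum>k\<le>N. coeff p k * ?m k)" if "degree p \<le> N" for p N
    unfolding L_def using that
    by (intro sum.mono_neutral_left) (auto simp: coeff_eq_0)
  have "L (p + r) = L p + L r" for p r
  proof -
    let ?N = "max (degree p) (degree r)"
    have "L (p + r) = (\<Sum>k\<le>?N. coeff (p + r) k * ?m k)"
      by (rule L_eq) (simp add: degree_add_le)
    also have "\<dots> = L p + L r"
      by (simp add: L_eq[of p ?N] L_eq[of r ?N] sum.distrib distrib_right)
    finally show ?thesis .
  qed
  moreover have "L (smult k p) = k * L p" for k p
  proof -
    have "L (smult k p) = (\<Sum>j\<le>degree p. coeff (smult k p) j * ?m j)"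
      by (rule L_eq) (rule degree_smult_le)
    also have "\<dots> = k * L p"
      by (simp add: L_def sum_distrib_left mult.assoc)
    finally show ?thesis .
  qed
  moreover have "L 1 = 1" by (simp add: L_def aw_moment_rec.simps)
  moreover have "L (?P n) = 0" if "n \<ge> 1" for n
  proof -
    have "L (?P n) = (\<Sum>k<Suc n. coeff (?P n) k * ?m k)"
      by (simp add: L_def lessThan_Suc_atMost degree_aw_poly)
    also have "\<dots> = (\<Sum>k<n. coeff (?P n) k * ?m k) + ?m n"
      by (simp add: coeff_aw_poly)
    also have "\<dots> = 0"
      using that by (subst (2) aw_moment_rec.simps) simp
    finally show ?thesis .
  qed
  ultimately show "\<exists>L. is_aw_functional a b c d q L"
    unfolding is_aw_functional_def linear_smult_iff by blast
next
  fix L M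
  assume LM: "is_aw_functional a b c d q L" "is_aw_functional a b c d q M"
  let ?P = "aw_poly a b c d q"
  have add: "L (p + r) = L p + L r" "M (p + r) = M p + M r"
    and sm: "L (smult k p) = k * L p" "M (smult k p) = k * M p" for p r k
    using LM unfolding is_aw_functional_def linear_smult_iff by blast+
  have P: "L (?P n) = M (?P n)" for n
    using LM by (cases n) (auto simp: is_aw_functional_def)
  have "degree p < n \<longrightarrow> L p = M p" for p n
  proof (induction n arbitrary: p)
    case (Suc n)
    show ?case
    proof
      assume deg: "degree p < Suc n"
      define r where "r = p - smult (coeff p n) (?P n)"
      have p: "p = r + smult (coeff p n) (?P n)" by (simp add: r_def)
      have "L r = M r"
      proof (cases "n = 0")
        case True
        then have "p = smult (coeff p n) (?P n)"
          using deg by (auto elim: degree_eq_zeroE)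
        then have "r = smult 0 0" by (simp add: r_def)
        then show ?thesis using sm[of 0 0] by simp
      next
        case False
        have "degree r \<le> n"
          unfolding r_def using deg
          by (intro degree_diff_le order.trans[OF degree_smult_le]) (auto simp: degree_aw_poly)
        moreover have "coeff r n = 0"
          by (simp add: r_def coeff_aw_poly)
        ultimately have "degree r < n"
          using False by (metis le_neq_implies_less leading_coeff_0_iff degree_0)
        then show ?thesis using Suc by blast
      qed
      then show "L p = M p"
        by (subst (1 2) p) (simp only: add sm P)
    qed
  qed auto
  then show "L = M" by blast
qed


text \<open>The polynomial ring \<open>\<int>[q][d][c][b][a]\<close>: the outermost variable is \<open>a\<close>, the innermost
  is \<open>q\<close>. Its fraction field is the field of rational functions in the five indeterminates;
  the embedding \<open>to_fract\<close> is injective, so a rational function is the image of at most one polynomial.\<close>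

type_synonym zpoly5 = "int poly poly poly poly poly"

definition ind_a :: "zpoly5 fract" where "ind_a = to_fract [:0, 1:]"
definition ind_b :: "zpoly5 fract" where "ind_b = to_fract [:[:0, 1:]:]"
definition ind_c :: "zpoly5 fract" where "ind_c = to_fract [:[:[:0, 1:]:]:]"
definition ind_d :: "zpoly5 fract" where "ind_d = to_fract [:[:[:[:0, 1:]:]:]:]"
definition ind_q :: "zpoly5 fract" where "ind_q = to_fract [:[:[:[:[:0, 1:]:]:]:]:]"

text \<open>\<open>coeff5 F i j k l m\<close> is the coefficient of \<open>a\<^sup>i b\<^sup>j c\<^sup>k d\<^sup>l q\<^sup>m\<close> in \<open>F\<close>.\<close>

definition coeff5 :: "zpoly5 \<Rightarrow> nat \<Rightarrow> nat \<Rightarrow> nat \<Rightarrow> nat \<Rightarrow> nat \<Rightarrow> int" where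
  "coeff5 F i j k l m = coeff (coeff (coeff (coeff (coeff F i) j) k) l) m"

end

(* The functional L_a satisfies L_a((1 - 2ax + a^2) p) = rho L_{aq}(p), where
   rho = (1-ab)(1-ac)(1-ad)/(1-abcd), because the kernel polynomials of P_n at x = (a + 1/a)/2 are
   the Askey-Wilson polynomials with a replaced by aq. Hence F_n(a) = 2^n (abcd;q)_n mu_n satisfies
     a F_{n+1}(a) = (1+a^2)(1-abcd q^n) F_n(a) - (1-ab)(1-ac)(1-ad) F_n(aq).
   The right-hand side vanishes at a = 0, so every F_n is an integer polynomial. On the extreme
   coefficients in c, d and q the recursion reduces to the one for nonnegative lattice paths with
   steps 1 and -1: the coefficient of a^i b^j c^n d^n q^(n choose 2) in F_n is (-1)^n times the
   number of n-step paths from 0 to 2n-i-j. The Catalan numbers are the values at endpoint 0. *)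

theory Submission
  imports Defs
begin

subsection \<open>The shift of a parameter\<close>

text \<open>With \<open>y = q^n\<close> the left side is the numerator of
  \<open>A_n(aq) - C_(n+1)(a)\<close>, with \<open>y = q^(n-1)\<close> that of
  \<open>A_n(a) - C_n(aq)\<close>. The last factor on the right cancels against their common
  denominator.\<close>

lemma aw_shift_numerator:
  fixes a b c d q y :: "'a::comm_ring_1"
  shows "(1 - a*b*q*y) * (1 - a*c*q*y) * (1 - a*d*q*y) * (1 - a*b*c*d*y)
      - a^2*q*(1 - q*y)*(1 - b*c*y)*(1 - b*d*y)*(1 - c*d*y)
    = (1 - a^2*q + (a^2*q*(b*c+b*d+c*d) + a^2*q^2 - a*q*(b+c+d) - a*b*c*d)*y
        + a*b*c*d*q*(1 - a^2*q)*y^2) * (1 - a*b*c*d*q*y^2)"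
  by (simp add: algebra_simps power2_eq_square)

text \<open>Needed for the diagonal recurrence coefficient: it turns \<open>b_n(aq)\<close> into
  \<open>(a + 1/a - A_n(a) - C_(n+1)(a)) / 2\<close>. The proof regroups the equation into the two
  differences with known numerators.\<close>

lemma aw_A_diff_C_shift:
  fixes a b c d q :: "'a::field"
  assumes "a \<noteq> 0" "q \<noteq> 0" and gen: "\<And>k. 1 - a*b*c*d*q^k \<noteq> 0"
  shows "aw_A a b c d q n + aw_C a b c d q (Suc n) - (a + inverse a)
    = aw_A (a*q) b c d q n + aw_C (a*q) b c d q n - (a*q + inverse (a*q))"
proof -
  define E where "E y = 1 - a^2*q + (a^2*q*(b*c+b*d+c*d) + a^2*q^2 - a*q*(b+c+d) - a*b*c*d)*y
        + a*b*c*d*q*(1 - a^2*q)*y^2" for y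
  have N: "(1 - a*b*q*y) * (1 - a*c*q*y) * (1 - a*d*q*y) * (1 - a*b*c*d*y)
      - a^2*q*(1 - q*y)*(1 - b*c*y)*(1 - b*d*y)*(1 - c*d*y) = E y * (1 - a*b*c*d*q*y^2)" for y
    unfolding E_def by (rule aw_shift_numerator)
  have up: "aw_A (a*q) b c d q n - aw_C a b c d q (Suc n) = E (q^n) / (a*q*(1 - a*b*c*d*q^(2*n)))"
  proof -
    have g: "1 - a*b*c*d*q^(2*n) \<noteq> 0" "1 - a*b*c*d*q^(2*n+1) \<noteq> 0" using gen by blast+
    have A: "aw_A (a*q) b c d q n = (1 - a*b*q*q^n) * (1 - a*c*q*q^n) * (1 - a*d*q*q^n) * (1 - a*b*c*d*q^n)
        / (a * q * (1 - a*b*c*d*q^(2*n)) * (1 - a*b*c*d*q^(2*n+1)))"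
    proof (cases n)
      case 0
      have "1 - a*b*c*d \<noteq> 0" using gen[of 0] by simp
      then show ?thesis using 0 by (simp add: aw_A_def mult_ac)
    next
      case (Suc m)
      then show ?thesis by (simp add: aw_A_def mult_ac)
    qed
    have C: "aw_C a b c d q (Suc n) = a^2*q*(1 - q*q^n)*(1 - b*c*q^n)*(1 - b*d*q^n)*(1 - c*d*q^n)
        / (a * q * (1 - a*b*c*d*q^(2*n)) * (1 - a*b*c*d*q^(2*n+1)))"
      using assms(1,2) by (simp add: aw_C_def power2_eq_square mult_ac)
    have "aw_A (a*q) b c d q n - aw_C a b c d q (Suc n)
      = E (q^n) * (1 - a*b*c*d*q*(q^n)^2) / (a * q * (1 - a*b*c*d*q^(2*n)) * (1 - a*b*c*d*q^(2*n+1)))"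
      unfolding A C N[symmetric] by (simp add: diff_divide_distrib)
    also have "a*b*c*d*q*(q^n)^2 = a*b*c*d*q^(2*n+1)" by (simp add: power_mult[symmetric] mult_ac)
    finally show ?thesis using g(2) by simp
  qed
  have "aw_A a b c d q n - aw_C (a*q) b c d q n
      = (a + inverse a) - (a*q + inverse (a*q)) + E (q^n) / (a*q*(1 - a*b*c*d*q^(2*n)))"
  proof (cases n)
    case 0
    have "a * b * c * d \<noteq> 1" using gen[of 0] by simp
    then show ?thesis using 0 assms(1,2)
      by (simp add: aw_A_def aw_C_def E_def field_simps power2_eq_square) 
  next
    case (Suc m)
    define y where "y = q^m"
    have g: "1 - a*b*c*d*q^(2*m+1) \<noteq> 0" "1 - a*b*c*d*q^(2*m+2) \<noteq> 0" using gen by blast+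
    have "aw_A a b c d q n - aw_C (a*q) b c d q n
      = E y * (1 - a*b*c*d*q*y^2) / (a * (1 - a*b*c*d*q^(2*m+1)) * (1 - a*b*c*d*q^(2*m+2)))"
      unfolding N[symmetric] using assms(1) Suc
      by (simp add: aw_A_def aw_C_def y_def diff_divide_distrib power2_eq_square mult_ac)
    also have "a*b*c*d*q*y^2 = a*b*c*d*q^(2*m+1)" by (simp add: y_def power_mult[symmetric] mult_ac)
    finally have 1: "aw_A a b c d q n - aw_C (a*q) b c d q n = E y / (a * (1 - a*b*c*d*q^(2*n)))"
      using g(1) Suc by simp
    \<comment> \<open>The weight \<open>q\<close> removes the term linear in \<open>y\<close>; the
      remainder contains \<open>1 - abcd q^(2n)\<close>, which cancels the denominator.\<close>
    have "q * E y - E (q * y) = (q - 1) * (1 - a^2*q) * (1 - a*b*c*d*(q*y)^2)"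
      unfolding E_def by algebra
    also have "(q*y)^2 = q^(2*n)"
      by (simp only: y_def Suc power_Suc[symmetric] power_mult[symmetric] mult.commute[of 2])
    also have "(q - 1) * (1 - a^2*q) = a*q*(a + inverse a - (a*q + inverse (a*q)))"
      using assms(1,2) by (simp add: field_simps power2_eq_square)
    finally have "E y = (a*q*(a + inverse a - (a*q + inverse (a*q))) * (1 - a*b*c*d*q^(2*n)) + E (q*y)) / q"
      using assms(2) by (simp add: field_simps)
    then have "E y / (a * (1 - a*b*c*d*q^(2*n)))
        = (a + inverse a - (a*q + inverse (a*q))) + E (q*y) / (a*q*(1 - a*b*c*d*q^(2*n)))"
      using assms(1,2) gen[of "2*n"] by (simp add: add_divide_distrib)
    then show ?thesis using 1 Suc by (simp add: y_def)
  qed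
  with up show ?thesis by (simp add: algebra_simps)
qed

text \<open>Needed for \<open>lambda_(n+1)(aq)\<close>. The shift exchanges the denominators of the
  two factors, and the extra powers of \<open>q\<close> cancel.\<close>

lemma aw_AC_shift:
  fixes a b c d q :: "'a::field"
  assumes "a \<noteq> 0" "q \<noteq> 0" "a*b*c*d \<noteq> 1"
  shows "aw_A (a*q) b c d q n * aw_C (a*q) b c d q (Suc n) = aw_A a b c d q (Suc n) * aw_C a b c d q (Suc n)"
proof (cases n)
  case 0
  then show ?thesis using assms by (simp add: aw_A_def aw_C_def power2_eq_square mult_ac)
next
  case (Suc m)
  then show ?thesis using assms by (simp add: aw_A_def aw_C_def mult_ac)
qed

text \<open>Kernel polynomials at \<open>x\<^sub>0 = (a + 1/a)/2\<close>, where \<open>P\<^sub>n(x\<^sub>0) = A\<^sub>0 \<cdots> A\<^sub>n\<^sub>-\<^sub>1 / 2\<^sup>n\<close>: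
  they are the Askey-Wilson polynomials with \<open>a\<close> replaced by \<open>a q\<close>.\<close>

lemma aw_kernel:
  fixes a b c d q :: "'a::field"
  assumes "a \<noteq> 0" "q \<noteq> 0" and gen: "\<And>k. 1 - a*b*c*d*q^k \<noteq> 0"
  defines "w \<equiv> [:- (a + inverse a) / 2, 1:]"
  defines "P \<equiv> aw_poly a b c d q" and "P' \<equiv> aw_poly (a*q) b c d q"
  defines "A \<equiv> aw_A a b c d q" and "C \<equiv> aw_C a b c d q"
  shows "w * P' n = P (Suc n) - smult (A n / 2) (P n)"
    and "P (Suc n) = P' (Suc n) - smult (C (Suc n) / 2) (P' n)"
proof -
  have b: "[:- aw_b a b c d q n, 1:] = w + [:(A n + C n) / 2:]" for n
    by (simp add: w_def aw_b_def A_def C_def add_divide_distrib diff_divide_distrib)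
  have b': "[:- aw_b (a*q) b c d q n, 1:] = w + [:(A n + C (Suc n)) / 2:]" for n
  proof -
    have "a*q + inverse (a*q) - (aw_A (a*q) b c d q n + aw_C (a*q) b c d q n)
        = a + inverse a - (A n + C (Suc n))"
      using aw_A_diff_C_shift[of a q b c d n] assms(1,2) gen by (simp add: A_def C_def algebra_simps)
    then have "aw_b (a*q) b c d q n = 1/2 * (a + inverse a - (A n + C (Suc n)))"
      by (simp only: aw_b_def)
    then show ?thesis by (simp add: w_def add_divide_distrib diff_divide_distrib)
  qed
  have lam: "aw_lambda a b c d q (Suc n) = A n * C (Suc n) / 4" for n
    by (simp add: aw_lambda_def A_def C_def)
  have lam': "aw_lambda (a*q) b c d q (Suc n) = A (Suc n) * C (Suc n) / 4" for n
    using aw_AC_shift[of a q b c d n] assms(1,2) gen[of 0] by (simp add: aw_lambda_def A_def C_def)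
  have rec: "P (Suc (Suc n)) = (w + [:(A (Suc n) + C (Suc n)) / 2:]) * P (Suc n)
      - smult (A n * C (Suc n) / 4) (P n)" for n
    by (simp only: P_def aw_poly.simps b lam)
  have rec': "P' (Suc (Suc n)) = (w + [:(A (Suc n) + C (Suc (Suc n))) / 2:]) * P' (Suc n)
      - smult (A (Suc n) * C (Suc n) / 4) (P' n)" for n
    by (simp only: P'_def aw_poly.simps b' lam')
  have P1: "P (Suc 0) = w + [:(A 0 + C 0) / 2:]" "P' (Suc 0) = w + [:(A 0 + C (Suc 0)) / 2:]"
    "P 0 = 1" "P' 0 = 1"
    by (simp_all only: P_def P'_def aw_poly.simps b b')
  have C0: "C 0 = 0" by (simp add: C_def aw_C_def)
  \<comment> \<open>Divisions by 2 and 4 become products with the polynomial \<open>h\<close>, so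
    that \<open>algebra\<close> meets pure ring identities.\<close>
  define h where "h = [:1 / (2::'a):]"
  have half: "[:x / 2:] = h * [:x:]" "[:x / 4:] = h * h * [:x:]" for x :: 'a
    by (simp_all add: h_def)
  \<comment> \<open>The two Jacobi matrices, shifted by \<open>x_0\<close>, are products of the same
    bidiagonal factors in opposite orders. The induction is joint: the first identity at
    \<open>n + 1\<close> needs both at \<open>n\<close>, the second needs the first at
    \<open>n + 1\<close>.\<close>
  have "w * P' n = P (Suc n) - smult (A n / 2) (P n) \<and>
        P (Suc n) = P' (Suc n) - smult (C (Suc n) / 2) (P' n)"
  proof (induction n)
    case 0
    then show ?case by (simp add: P1 C0 w_def field_simps one_pCons)
  next
    case (Suc n)
    have sm: "smult x p = [:x:] * p" for x :: 'a and p by simp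
    have ad: "[:x + y:] = [:x:] + [:y:]" "[:x * y:] = [:x:] * [:y:]" for x y :: 'a by simp_all
    from Suc have IH: "w * P' n = P (Suc n) - h * [:A n:] * P n"
        "P (Suc n) = P' (Suc n) - h * [:C (Suc n):] * P' n"
      by (simp_all only: sm half)
    have r: "P (Suc (Suc n)) = (w + h * ([:A (Suc n):] + [:C (Suc n):])) * P (Suc n)
      - h * h * ([:A n:] * [:C (Suc n):]) * P n"
     and r': "P' (Suc (Suc n)) = (w + h * ([:A (Suc n):] + [:C (Suc (Suc n)):])) * P' (Suc n)
      - h * h * ([:A (Suc n):] * [:C (Suc n):]) * P' n"
      unfolding rec rec' by (simp_all only: sm half ad)
    have 1: "w * P' (Suc n) = P (Suc (Suc n)) - h * [:A (Suc n):] * P (Suc n)"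
      using IH r by algebra
    have 2: "P (Suc (Suc n)) = P' (Suc (Suc n)) - h * [:C (Suc (Suc n)):] * P' (Suc n)"
      using IH(2) r' 1 by algebra
    from 1 2 show ?case by (simp only: sm half)
  qed
  then show "w * P' n = P (Suc n) - smult (A n / 2) (P n)"
    and "P (Suc n) = P' (Suc n) - smult (C (Suc n) / 2) (P' n)" by blast+
qed

section \<open>The moment functional and its moments under the shift of \<open>a\<close>\<close>

lemma is_aw_functional_aw_functional: "is_aw_functional a b c d q (aw_functional a b c d q)"
  unfolding aw_functional_def by (rule theI'[OF ex1_aw_functional])

lemma aw_functional_unique: "is_aw_functional a b c d q L \<Longrightarrow> L = aw_functional a b c d q"
  using ex1_aw_functional is_aw_functional_aw_functional by blast

lemma aw_functional_add: "aw_functional a b c d q (p + r) = aw_functional a b c d q p + aw_functional a b c d q r"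
  and aw_functional_smult: "aw_functional a b c d q (smult k p) = k * aw_functional a b c d q p"
  and aw_functional_1: "aw_functional a b c d q 1 = 1"
  and aw_functional_aw_poly: "n > 0 \<Longrightarrow> aw_functional a b c d q (aw_poly a b c d q n) = 0"
  using is_aw_functional_aw_functional[of a b c d q]
  by (auto simp: is_aw_functional_def linear_smult_iff Suc_le_eq)

lemma aw_functional_diff: "aw_functional a b c d q (p - r) = aw_functional a b c d q p - aw_functional a b c d q r"
  using aw_functional_add[of a b c d q "p - r" r] by simp

text \<open>The linear factor is \<open>-2a (x - x_0)\<close>, and the kernel identity expresses
  \<open>(x - x_0) P'_n\<close> by \<open>P_(n+1)\<close> and \<open>P_n\<close>. The functional
  kills this unless \<open>n = 0\<close>, where \<open>-2a * (-A_0/2) = a A_0\<close> is the factor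
  on the right.\<close>

lemma aw_functional_shift:
  fixes a b c d q :: "'a::field"
  assumes "a \<noteq> 0" "q \<noteq> 0" "(2::'a) \<noteq> 0" and gen: "\<And>k. 1 - a*b*c*d*q^k \<noteq> 0"
  shows "aw_functional a b c d q ([:1 + a^2, - 2 * a:] * p)
    = (1 - a*b) * (1 - a*c) * (1 - a*d) / (1 - a*b*c*d) * aw_functional (a*q) b c d q p"
proof -
  define L where "L = aw_functional a b c d q"
  define L' where "L' = aw_functional (a*q) b c d q"
  define A where "A = aw_A a b c d q"
  define rho where "rho = (1 - a*b) * (1 - a*c) * (1 - a*d) / (1 - a*b*c*d)"
  define w where "w = [:- (a + inverse a) / 2, 1:]"
  (* Written so that M is an Askey-Wilson functional even where rho vanishes. *)
  define M where "M p = L' p + (L ([:1 + a^2, - 2 * a:] * p) - rho * L' p)" for p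
  note lin = aw_functional_add aw_functional_smult aw_functional_diff
  have w: "[:1 + a^2, - 2 * a:] = smult (- 2 * a) w"
    using assms(1,3) by (simp add: w_def field_simps power2_eq_square)
  have val: "L ([:1 + a^2, - 2 * a:] * aw_poly (a*q) b c d q n)
      = - 2 * a * (L (aw_poly a b c d q (Suc n)) - A n / 2 * L (aw_poly a b c d q n))" for n
  proof -
    have "w * aw_poly (a*q) b c d q n = aw_poly a b c d q (Suc n) - smult (A n / 2) (aw_poly a b c d q n)"
      unfolding w_def A_def using aw_kernel(1)[OF assms(1,2) gen] .
    then show ?thesis by (simp only: w mult_smult_left L_def lin)
  qed
  have pos: "L (aw_poly a b c d q n) = (if n = 0 then 1 else 0)" for n
    by (simp add: L_def aw_functional_1 aw_functional_aw_poly)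
  have "is_aw_functional (a*q) b c d q M"
    unfolding is_aw_functional_def linear_smult_iff
  proof (intro conjI allI impI)
    show "M (p + r) = M p + M r" for p r
      by (simp only: M_def L_def L'_def lin distrib_left) (simp add: algebra_simps)
    show "M (smult k p) = k * M p" for k p
      by (simp only: M_def L_def L'_def lin mult_smult_right) (simp add: algebra_simps)
    have "a * A 0 = rho" using assms(1) by (simp add: A_def aw_A_def rho_def)
    then show "M 1 = 1"
      using val[of 0, unfolded pos] assms(3) by (simp add: M_def L'_def aw_functional_1)
    show "M (aw_poly (a*q) b c d q n) = 0" if "n \<ge> 1" for n
      using that by (simp only: M_def val pos) (simp add: L'_def aw_functional_aw_poly)
  qed
  then have "M = L'" unfolding L'_def by (rule aw_functional_unique)
  then have "M p = L' p" by simp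
  then show ?thesis by (simp add: M_def L_def L'_def rho_def)
qed

lemma aw_moment_0: "aw_moment a b c d q 0 = 1"
  by (simp add: aw_moment_def aw_functional_1)

lemma aw_moment_Suc:
  fixes a b c d q :: "'a::field"
  assumes "a \<noteq> 0" "q \<noteq> 0" "(2::'a) \<noteq> 0" and gen: "\<And>k. 1 - a*b*c*d*q^k \<noteq> 0"
  shows "2 * a * aw_moment a b c d q (Suc n) = (1 + a^2) * aw_moment a b c d q n
    - (1 - a*b) * (1 - a*c) * (1 - a*d) / (1 - a*b*c*d) * aw_moment (a*q) b c d q n"
proof -
  have "[:1 + a^2, - 2 * a:] * monom 1 n = smult (1 + a^2) (monom 1 n) - smult (2 * a) (monom 1 (Suc n))"
    by (simp add: smult_monom monom_Suc) (simp add: smult_monom monom_Suc flip: minus_monom)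
  then have "(1 + a^2) * aw_moment a b c d q n - 2 * a * aw_moment a b c d q (Suc n)
    = (1 - a*b) * (1 - a*c) * (1 - a*d) / (1 - a*b*c*d) * aw_moment (a*q) b c d q n"
    using aw_functional_shift[OF assms(1-3) gen, of "monom 1 n"]
    by (simp only: aw_moment_def aw_functional_diff aw_functional_smult)
  moreover have "y = x - z" if "x - y = z" for x y z :: 'a
    using that by auto
  ultimately show ?thesis by blast
qed

lemma q_pochhammer_0: "q_pochhammer x q 0 = 1"
  and q_pochhammer_Suc: "q_pochhammer x q (Suc n) = q_pochhammer x q n * (1 - x * q ^ n)"
  by (simp_all add: q_pochhammer_def)

lemma q_pochhammer_Suc_shift: "q_pochhammer x q (Suc n) = (1 - x) * q_pochhammer (x * q) q n"
  by (simp add: q_pochhammer_def prod.lessThan_Suc_shift mult.assoc del: prod.lessThan_Suc)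

definition aw_scaled_moment :: "'a::field \<Rightarrow> 'a \<Rightarrow> 'a \<Rightarrow> 'a \<Rightarrow> 'a \<Rightarrow> nat \<Rightarrow> 'a" where
  "aw_scaled_moment a b c d q n = 2^n * q_pochhammer (a*b*c*d) q n * aw_moment a b c d q n"

lemma aw_scaled_moment_0: "aw_scaled_moment a b c d q 0 = 1"
  by (simp add: aw_scaled_moment_def q_pochhammer_0 aw_moment_0)

text \<open>In the unshifted term \<open>(abcd;q)_(n+1)\<close> gives up its last factor; in the
  shifted term it gives up its first, which clears \<open>1 - abcd\<close> and leaves the
  normalization belonging to \<open>aq\<close>.\<close>

lemma aw_scaled_moment_Suc:
  fixes a b c d q :: "'a::field"
  assumes "a \<noteq> 0" "q \<noteq> 0" "(2::'a) \<noteq> 0" and gen: "\<And>k. 1 - a*b*c*d*q^k \<noteq> 0"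
  shows "a * aw_scaled_moment a b c d q (Suc n)
    = (1 + a^2) * (1 - a*b*c*d*q^n) * aw_scaled_moment a b c d q n
      - (1 - a*b) * (1 - a*c) * (1 - a*d) * aw_scaled_moment (a*q) b c d q n"
proof -
  let ?s = "a*b*c*d" and ?r = "(1 - a*b) * (1 - a*c) * (1 - a*d)"
  have s: "1 - ?s \<noteq> 0" using gen[of 0] by simp
  have sq: "a*q*b*c*d = ?s * q" by (simp add: mult_ac)
  have "a * aw_scaled_moment a b c d q (Suc n)
      = 2^n * q_pochhammer ?s q (Suc n) * (2 * a * aw_moment a b c d q (Suc n))"
    by (simp add: aw_scaled_moment_def mult_ac)
  also have "\<dots> = 2^n * q_pochhammer ?s q (Suc n) * ((1 + a^2) * aw_moment a b c d q n)
      - 2^n * q_pochhammer ?s q (Suc n) * (?r / (1 - ?s) * aw_moment (a*q) b c d q n)"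
    unfolding aw_moment_Suc[OF assms(1-3) gen] by (rule right_diff_distrib)
  also have "2^n * q_pochhammer ?s q (Suc n) * ((1 + a^2) * aw_moment a b c d q n)
      = (1 + a^2) * (1 - ?s*q^n) * aw_scaled_moment a b c d q n"
    by (simp only: aw_scaled_moment_def q_pochhammer_Suc mult_ac)
  also have "2^n * q_pochhammer ?s q (Suc n) * (?r / (1 - ?s) * aw_moment (a*q) b c d q n)
      = ?r * aw_scaled_moment (a*q) b c d q n"
    using s by (simp add: aw_scaled_moment_def q_pochhammer_Suc_shift sq)
  finally show ?thesis .
qed


subsection \<open>Dyck prefixes and Catalan numbers\<close>

text \<open>Nonnegative paths with \<open>n\<close> steps from 0 to height \<open>j\<close>; the
  recursion removes the last step.\<close>

fun dyck_prefixes :: "nat \<Rightarrow> nat \<Rightarrow> nat" where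
  "dyck_prefixes 0 j = (if j = 0 then 1 else 0)"
| "dyck_prefixes (Suc n) 0 = dyck_prefixes n 1"
| "dyck_prefixes (Suc n) (Suc j) = dyck_prefixes n j + dyck_prefixes n (Suc (Suc j))"

lemma dyck_prefixes_eq_0: "j > n \<Longrightarrow> dyck_prefixes n j = 0"
  by (induction n j rule: dyck_prefixes.induct) auto

lemma dyck_prefixes_odd: "odd (n + j) \<Longrightarrow> dyck_prefixes n j = 0"
  by (induction n j rule: dyck_prefixes.induct) (auto simp: odd_pos)

text \<open>Reflection principle: \<open>k\<close> counts down-steps, and paths reaching -1
  correspond to unrestricted ones with \<open>k - 1\<close> down-steps. The induction needs only
  Pascal's rule.\<close>

lemma dyck_prefixes_ballot:
  "dyck_prefixes (2*k + j) j + (if k = 0 then 0 else (2*k + j) choose (k - 1)) = (2*k + j) choose k"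
proof (induction "2*k + j" arbitrary: k j)
  case 0
  then show ?case by simp
next
  case (Suc n)
  show ?case
  proof (cases j)
    case 0
    then obtain l where k: "k = Suc l" using Suc.hyps(2) by (cases k) auto
    have n: "n = 2*l + 1" using Suc.hyps(2) k 0 by simp
    have IH: "dyck_prefixes n 1 + (if l = 0 then 0 else n choose (l - 1)) = n choose l"
      using Suc.hyps(1)[of l 1] by (simp only: n split: if_splits)
    \<comment> \<open>Height 0 has a single predecessor; the equal middle binomials of the odd row
      \<open>n = 2l + 1\<close> make up for the missing one.\<close>
    have "n choose Suc l = n choose l"
      using binomial_symmetric[of "Suc l" n] n by simp
    then have "dyck_prefixes (Suc n) 0 + (Suc n choose l) = Suc n choose Suc l"
      using IH by (cases l) auto
    then show ?thesis using n 0 k by simp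
  next
    case (Suc i)
    have n: "n = 2*k + i" using Suc.hyps(2) Suc by simp
    have IH1: "dyck_prefixes n i + (if k = 0 then 0 else n choose (k - 1)) = n choose k"
      using Suc.hyps(1)[of k i] by (simp only: n split: if_splits)
    show ?thesis
    proof (cases k)
      case 0
      then show ?thesis using IH1 n Suc by (simp add: dyck_prefixes_eq_0)
    next
      case (Suc l)
      have "dyck_prefixes n (i + 2) + (if l = 0 then 0 else n choose (l - 1)) = n choose l"
        using Suc.hyps(1)[of l "i + 2"] n Suc by (simp del: dyck_prefixes.simps split: if_splits)
      then have "dyck_prefixes (Suc n) (Suc i) + (Suc n choose l) = Suc n choose Suc l"
        using IH1 Suc by (cases l) auto
      then show ?thesis using n Suc \<open>j = Suc i\<close> by simp
    qed
  qed
qed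

lemma Cat_of_nat: "Cat (of_nat m) = of_nat ((2*m) choose m) / of_nat (m + 1)"
proof -
  have "nat \<lfloor>2 * of_nat m :: rat\<rfloor> = 2 * m"
    by (metis floor_of_nat nat_int of_nat_mult of_nat_numeral)
  then show ?thesis by (simp add: Cat_def add.commute)
qed

text \<open>Both sides vanish for odd \<open>n\<close>. For \<open>n = 2m\<close> the ballot
  difference of the binomials over \<open>m\<close> and \<open>m - 1\<close> becomes the Catalan
  quotient by absorption.\<close>

lemma Cat_half: "Cat (of_nat n / 2) = of_nat (dyck_prefixes n 0)"
proof (cases "even n")
  case True
  then obtain m where n: "n = 2*m" by blast
  have "(of_nat n / 2 :: rat) = of_nat m" by (simp add: n)
  moreover have "of_nat (dyck_prefixes n 0) * (of_nat (m + 1) :: rat) = of_nat ((2*m) choose m)"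
  proof (cases m)
    case 0
    then show ?thesis by (simp add: n)
  next
    case (Suc k)
    have "(2*m - k) * ((2*m) choose k) = Suc k * ((2*m) choose Suc k)"
      by (simp only: binomial_absorb_comp binomial_absorption)
    then have "(m + 1) * ((2*m) choose k) = m * ((2*m) choose m)"
      using Suc by simp
    moreover have "(dyck_prefixes n 0 + ((2*m) choose k)) * (m + 1) = ((2*m) choose m) * (m + 1)"
      using dyck_prefixes_ballot[of m 0] Suc n by simp
    ultimately have "dyck_prefixes n 0 * (m + 1) = (2*m) choose m"
      by (simp add: algebra_simps)
    then show ?thesis by (metis of_nat_mult)
  qed
  ultimately show ?thesis
    by (simp only: Cat_of_nat) (simp add: field_simps)
next
  case False
  have "(of_nat n / 2 :: rat) \<notin> \<nat>"
  proof
    assume "(of_nat n / 2 :: rat) \<in> \<nat>"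
    then obtain m where "of_nat n / 2 = (of_nat m :: rat)" by (elim Nats_cases)
    then have "of_nat n = (of_nat (2*m) :: rat)" by simp
    then have "n = 2*m" by (simp only: of_nat_eq_iff)
    then show False using False by simp
  qed
  then show ?thesis using False by (simp add: Cat_def dyck_prefixes_odd)
qed

text \<open>Before its last two steps a path ending at 0 is at height 0 or 2. This yields the
  difference of Catalan numbers in the second coefficient.\<close>

lemma dyck_prefixes_2: "dyck_prefixes n 2 + dyck_prefixes n 0 = dyck_prefixes (n + 2) 0"
  by (simp add: numeral_2_eq_2)


subsection \<open>The recursion over the integers\<close>

definition mono5 :: "nat \<Rightarrow> nat \<Rightarrow> nat \<Rightarrow> nat \<Rightarrow> nat \<Rightarrow> zpoly5" where
  "mono5 i j k l m = monom (monom (monom (monom (monom 1 m) l) k) j) i"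

lemma mono5_0: "mono5 0 0 0 0 0 = 1"
  by (simp add: mono5_def monom_eq_1)

lemma mono5_mult:
  "mono5 i j k l m * mono5 i' j' k' l' m' = mono5 (i + i') (j + j') (k + k') (l + l') (m + m')"
  by (simp add: mono5_def mult_monom)

lemma coeff5_mono5_mult:
  "coeff5 (mono5 x y z w v * f) i j k l m =
    (if x \<le> i \<and> y \<le> j \<and> z \<le> k \<and> w \<le> l \<and> v \<le> m
     then coeff5 f (i - x) (j - y) (k - z) (l - w) (m - v) else 0)"
  by (auto simp: coeff5_def mono5_def coeff_monom_mult)

lemma coeff5_add: "coeff5 (f + g) i j k l m = coeff5 f i j k l m + coeff5 g i j k l m"
  and coeff5_diff: "coeff5 (f - g) i j k l m = coeff5 f i j k l m - coeff5 g i j k l m"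
  by (simp_all add: coeff5_def)

lemma coeff5_1: "coeff5 1 i j k l m = (if i = 0 \<and> j = 0 \<and> k = 0 \<and> l = 0 \<and> m = 0 then 1 else 0)"
  by (auto simp: coeff5_def coeff_1)

lemma zpoly5_eqI: "(\<And>i j k l m. coeff5 f i j k l m = coeff5 g i j k l m) \<Longrightarrow> f = g"
  by (simp add: coeff5_def poly_eq_iff)

text \<open>The substitution \<open>a \<mapsto> a q\<^sup>r\<close>.\<close>

definition dilate :: "nat \<Rightarrow> zpoly5 \<Rightarrow> zpoly5" where
  "dilate r f = pcompose f (monom (monom (monom (monom (monom 1 r) 0) 0) 0) 1)"

lemma coeff5_dilate:
  "coeff5 (dilate r f) i j k l m = (if r * i \<le> m then coeff5 f i j k l (m - r * i) else 0)"
  by (auto simp: dilate_def coeff5_def coeff_monom_mult monom_power)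

lemma dilate_0: "dilate 0 f = f"
  by (rule zpoly5_eqI) (simp add: coeff5_dilate)

lemma dilate_dilate: "dilate r (dilate s f) = dilate (r + s) f"
  by (rule zpoly5_eqI) (auto simp: coeff5_dilate algebra_simps)

lemma dilate_hom:
  "dilate r (f + g) = dilate r f + dilate r g"
  "dilate r (f - g) = dilate r f - dilate r g"
  "dilate r (f * g) = dilate r f * dilate r g"
  "dilate r 1 = 1"
  by (simp_all add: dilate_def pcompose_add pcompose_diff pcompose_mult pcompose_1)

lemma dilate_mono5: "dilate r (mono5 i j k l m) = mono5 i j k l (m + r * i)"
proof (rule zpoly5_eqI)
  fix i' j' k' l' m'
  \<comment> \<open>The factor 1 lets the product rule for coefficients evaluate a lone
    monomial.\<close>
  have "coeff5 (dilate r (mono5 i j k l m * 1)) i' j' k' l' m' = coeff5 (mono5 i j k l (m + r * i) * 1) i' j' k' l' m'"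
    unfolding coeff5_dilate coeff5_mono5_mult coeff5_1 by auto
  then show "coeff5 (dilate r (mono5 i j k l m)) i' j' k' l' m' = coeff5 (mono5 i j k l (m + r * i)) i' j' k' l' m'"
    by simp
qed

lemma ind_conv_mono5:
  "ind_a = to_fract (mono5 1 0 0 0 0)" "ind_b = to_fract (mono5 0 1 0 0 0)"
  "ind_c = to_fract (mono5 0 0 1 0 0)" "ind_d = to_fract (mono5 0 0 0 1 0)"
  "ind_q = to_fract (mono5 0 0 0 0 1)"
  by (simp_all add: ind_a_def ind_b_def ind_c_def ind_d_def ind_q_def mono5_def monom_0 monom_Suc one_pCons)

lemma to_fract_power: "to_fract (x ^ n) = to_fract x ^ n"
  by (induction n) simp_all

lemma mono5_power: "mono5 i j k l m ^ n = mono5 (n * i) (n * j) (n * k) (n * l) (n * m)"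
  by (induction n) (simp_all add: mono5_0 mono5_mult)

lemma to_fract_mono5: "to_fract (mono5 i j k l m) = ind_a^i * ind_b^j * ind_c^k * ind_d^l * ind_q^m"
  unfolding ind_conv_mono5 to_fract_power[symmetric] mono5_power to_fract_mult[symmetric] mono5_mult
  by simp

section \<open>Integer polynomials for the scaled moments\<close>

definition aw_step :: "nat \<Rightarrow> zpoly5 \<Rightarrow> zpoly5" where
  "aw_step n f = (1 + mono5 2 0 0 0 0) * (1 - mono5 1 1 1 1 n) * f
    - (1 - mono5 1 1 0 0 0) * (1 - mono5 1 0 1 0 0) * (1 - mono5 1 0 0 1 0) * dilate 1 f"

text \<open>In this form every coefficient of \<open>aw_step n f\<close> is a signed sum of shifted
  coefficients of \<open>f\<close>.\<close>

lemma aw_step_expand: "aw_step n f = f + mono5 2 0 0 0 0 * f - mono5 1 1 1 1 n * f - mono5 3 1 1 1 n * f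
    - dilate 1 f + mono5 1 1 0 0 0 * dilate 1 f + mono5 1 0 1 0 0 * dilate 1 f + mono5 1 0 0 1 0 * dilate 1 f
    - mono5 2 1 1 0 0 * dilate 1 f - mono5 2 1 0 1 0 * dilate 1 f - mono5 2 0 1 1 0 * dilate 1 f
    + mono5 3 1 1 1 0 * dilate 1 f"
proof -
  have "mono5 3 1 1 1 n = mono5 2 0 0 0 0 * mono5 1 1 1 1 n"
    "mono5 2 1 1 0 0 = mono5 1 1 0 0 0 * mono5 1 0 1 0 0"
    "mono5 2 1 0 1 0 = mono5 1 1 0 0 0 * mono5 1 0 0 1 0"
    "mono5 2 0 1 1 0 = mono5 1 0 1 0 0 * mono5 1 0 0 1 0"
    "mono5 3 1 1 1 0 = mono5 1 1 0 0 0 * (mono5 1 0 1 0 0 * mono5 1 0 0 1 0)"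
    unfolding mono5_mult by (simp_all add: numeral_2_eq_2 numeral_3_eq_3)
  then show ?thesis unfolding aw_step_def by (simp only:) (simp add: algebra_simps)
qed

text \<open>The shift by one divides by \<open>a\<close>; see \<open>mono5_aw_moment_poly_Suc\<close> for exactness.\<close>

primrec aw_moment_poly :: "nat \<Rightarrow> zpoly5" where
  "aw_moment_poly 0 = 1"
| "aw_moment_poly (Suc n) = poly_shift 1 (aw_step n (aw_moment_poly n))"

lemma coeff5_aw_moment_poly_Suc:
  "coeff5 (aw_moment_poly (Suc n)) i j k l m = coeff5 (aw_step n (aw_moment_poly n)) (Suc i) j k l m"
  by (simp add: coeff5_def coeff_poly_shift)

lemma mono5_aw_moment_poly_Suc: "mono5 1 0 0 0 0 * aw_moment_poly (Suc n) = aw_step n (aw_moment_poly n)"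
proof (rule zpoly5_eqI)
  fix i j k l m
  show "coeff5 (mono5 1 0 0 0 0 * aw_moment_poly (Suc n)) i j k l m = coeff5 (aw_step n (aw_moment_poly n)) i j k l m"
  proof (cases i)
    \<comment> \<open>Exactness of the division: at \<open>a^0\<close> only
      \<open>f - dilate 1 f\<close> contributes, and \<open>dilate\<close> fixes the coefficients
      free of \<open>a\<close>.\<close>
    case 0
    then show ?thesis
      by (simp add: aw_step_expand coeff5_add coeff5_diff coeff5_mono5_mult coeff5_dilate)
  next
    case (Suc i')
    then show ?thesis by (simp add: coeff5_mono5_mult coeff5_aw_moment_poly_Suc del: aw_moment_poly.simps)
  qed
qed

section \<open>Coefficient recursion, degree bounds and extreme coefficients\<close>

lemma choose_two_Suc: "Suc n choose 2 = (n choose 2) + n"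
  by (simp add: numeral_2_eq_2)

text \<open>Integer exponents turn multiplication by a monomial into an unconditional index shift.\<close>

definition coeff5_int :: "zpoly5 \<Rightarrow> int \<Rightarrow> int \<Rightarrow> int \<Rightarrow> int \<Rightarrow> int \<Rightarrow> int" where
  "coeff5_int f i j k l m = (if 0 \<le> i \<and> 0 \<le> j \<and> 0 \<le> k \<and> 0 \<le> l \<and> 0 \<le> m
     then coeff5 f (nat i) (nat j) (nat k) (nat l) (nat m) else 0)"

lemma coeff5_int_of_nat: "coeff5_int f (int i) (int j) (int k) (int l) (int m) = coeff5 f i j k l m"
  by (simp add: coeff5_int_def)

lemma coeff5_int_neg:
  "i < 0 \<or> j < 0 \<or> k < 0 \<or> l < 0 \<or> m < 0 \<Longrightarrow> coeff5_int f i j k l m = 0"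
  by (auto simp: coeff5_int_def)

lemma coeff5_int_add: "coeff5_int (f + g) i j k l m = coeff5_int f i j k l m + coeff5_int g i j k l m"
  and coeff5_int_diff: "coeff5_int (f - g) i j k l m = coeff5_int f i j k l m - coeff5_int g i j k l m"
  by (simp_all add: coeff5_int_def coeff5_add coeff5_diff)

lemma coeff5_int_mono5_mult: "coeff5_int (mono5 x y z w v * f) i j k l m
    = coeff5_int f (i - int x) (j - int y) (k - int z) (l - int w) (m - int v)"
proof -
  have *: "x \<le> nat i \<longleftrightarrow> int x \<le> i" if "0 \<le> i" for x i
    using that by linarith
  show ?thesis
    by (auto simp: coeff5_int_def coeff5_mono5_mult * nat_diff_distrib)
qed

lemma coeff5_int_dilate: "coeff5_int (dilate r f) i j k l m = coeff5_int f i j k l (m - int r * i)"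
proof (cases "0 \<le> i \<and> 0 \<le> j \<and> 0 \<le> k \<and> 0 \<le> l \<and> 0 \<le> m")
  case True
  have "r * nat i \<le> nat m \<longleftrightarrow> int r * i \<le> m"
    using True by (metis int_nat_eq nat_int nat_le_iff nat_mono of_nat_mult)
  moreover have "nat (m - int r * i) = nat m - r * nat i"
    using True by (simp add: nat_diff_distrib' nat_mult_distrib)
  ultimately show ?thesis
    using True by (simp add: coeff5_int_def coeff5_dilate)
next
  case False
  then show ?thesis
    by (auto simp: coeff5_int_def) (smt (verit) mult_nonneg_nonneg of_nat_0_le_iff)
qed

text \<open>Compares coefficients of \<open>a^(i+1)\<close> in the recursion for
  \<open>a F_(n+1)\<close>. In a dilated term the exponent of \<open>q\<close> drops by the exponent
  of \<open>a\<close> left after removing the monomial.\<close>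

lemma coeff5_int_aw_moment_poly_Suc:
  fixes n :: nat
  assumes "0 \<le> i"
  defines "t \<equiv> coeff5_int (aw_moment_poly n)"
  shows "coeff5_int (aw_moment_poly (Suc n)) i j k l m =
    t (i + 1) j k l m + t (i - 1) j k l m
    - t i (j - 1) (k - 1) (l - 1) (m - int n) - t (i - 2) (j - 1) (k - 1) (l - 1) (m - int n)
    - t (i + 1) j k l (m - (i + 1))
    + t i (j - 1) k l (m - i) + t i j (k - 1) l (m - i) + t i j k (l - 1) (m - i)
    - t (i - 1) (j - 1) (k - 1) l (m - (i - 1)) - t (i - 1) (j - 1) k (l - 1) (m - (i - 1))
    - t (i - 1) j (k - 1) (l - 1) (m - (i - 1))
    + t (i - 2) (j - 1) (k - 1) (l - 1) (m - (i - 2))"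
proof -
  have "coeff5_int (aw_moment_poly (Suc n)) i j k l m
      = coeff5_int (mono5 1 0 0 0 0 * aw_moment_poly (Suc n)) (i + 1) j k l m"
    by (simp add: coeff5_int_mono5_mult)
  also have "\<dots> = coeff5_int (aw_step n (aw_moment_poly n)) (i + 1) j k l m"
    by (simp only: mono5_aw_moment_poly_Suc)
  finally show ?thesis
    by (simp add: t_def aw_step_expand coeff5_int_add coeff5_int_diff coeff5_int_mono5_mult coeff5_int_dilate)
qed

text \<open>One step adds at most one degree in each of \<open>b\<close>, \<open>c\<close>,
  \<open>d\<close>. The bound in \<open>a\<close> rests on a cancellation, and the bound in
  \<open>q\<close> uses the one in \<open>a\<close>, so all are proved together.\<close>

lemma coeff5_int_aw_moment_poly_eq_0:
  assumes "i > int n \<or> j > int n \<or> k > int n \<or> l > int n \<or> m > int (n choose 2)"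
  shows "coeff5_int (aw_moment_poly n) i j k l m = 0"
  using assms
proof (induction n arbitrary: i j k l m)
  case 0
  then show ?case by (auto simp: coeff5_int_def coeff5_1)
next
  case (Suc n)
  show ?case
  proof (cases "0 \<le> i")
    case i: True
    note rec = coeff5_int_aw_moment_poly_Suc[OF i]
    from Suc.prems consider "i > int (Suc n)" | "j > int (Suc n)" | "k > int (Suc n)" | "l > int (Suc n)"
      | "m > int (n choose 2) + int n"
      by (auto simp: choose_two_Suc)
    then show ?thesis
    proof cases
      case 1
      \<comment> \<open>At \<open>i = n + 2\<close> only the two terms at \<open>i - 2\<close>
        remain; their \<open>q\<close>-exponents \<open>m - n\<close> and \<open>m - (i - 2)\<close>
        agree, so they cancel.\<close>
      then have "i = int n + 2 \<or> i - 2 > int n" by auto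
      then show ?thesis
      proof
        assume "i = int n + 2"
        then show ?thesis unfolding rec by (simp add: Suc.IH)
      next
        assume "i - 2 > int n"
        then show ?thesis unfolding rec by (simp add: Suc.IH)
      qed
    next
      case 2
      then show ?thesis unfolding rec by (simp add: Suc.IH)
    next
      case 3
      then show ?thesis unfolding rec by (simp add: Suc.IH)
    next
      case 4
      then show ?thesis unfolding rec by (simp add: Suc.IH)
    next
      case 5
      then have "m > int (n choose 2)" "m - int n > int (n choose 2)" by auto
      \<comment> \<open>Either \<open>i' > n\<close> and the bound in \<open>a\<close> applies, or
        \<open>m - i' \<ge> m - n\<close> exceeds the bound in \<open>q\<close>.\<close>
      moreover have "coeff5_int (aw_moment_poly n) i' j' k' l' (m - i') = 0" for i' j' k' l'
        using 5 by (intro Suc.IH) linarith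
      ultimately show ?thesis unfolding rec by (simp only: Suc.IH simp_thms)
    qed
  qed (simp add: coeff5_int_neg)
qed

text \<open>The sum \<open>(n - i) + (n - j)\<close> plays the height of a path: the surviving terms
  of the recursion change it by one and flip the sign.\<close>

lemma coeff5_int_aw_moment_poly_top:
  assumes "i \<le> int n" "j \<le> int n"
  shows "coeff5_int (aw_moment_poly n) i j (int n) (int n) (int (n choose 2)) =
    (-1)^n * int (dyck_prefixes n (nat ((int n - i) + (int n - j))))"
  using assms
proof (induction n arbitrary: i j)
  case 0
  then show ?case by (auto simp: coeff5_int_def coeff5_1)
next
  case (Suc n)
  let ?t = "\<lambda>i j. coeff5_int (aw_moment_poly n) i j (int n) (int n) (int (n choose 2))"
  show ?case
  proof (cases "0 \<le> i \<and> 0 \<le> j")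
    \<comment> \<open>A negative exponent puts the endpoint higher than the number of steps.\<close>
    case False
    then show ?thesis
      using Suc.prems by (subst dyck_prefixes_eq_0) (auto simp: coeff5_int_neg)
  next
    case True
    note zero = coeff5_int_aw_moment_poly_eq_0
    \<comment> \<open>Only terms lowering both \<open>c\<close> and \<open>d\<close> survive. Of the
      dilated ones, that at \<open>i - 1\<close> respects the \<open>q\<close>-bound only for
      \<open>i = n + 1\<close>, and that at \<open>i - 2\<close> would need
      \<open>i \<ge> n + 2\<close>.\<close>
    have "coeff5_int (aw_moment_poly (Suc n)) i j (int (Suc n)) (int (Suc n)) (int (Suc n choose 2))
      = - ?t i (j - 1) - ?t (i - 2) (j - 1) - (if i = int n + 1 then ?t (i - 1) j else 0)"
      using True Suc.prems
      by (simp add: coeff5_int_aw_moment_poly_Suc choose_two_Suc zero del: aw_moment_poly.simps)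
    also have "\<dots> = (-1)^Suc n * int (dyck_prefixes (Suc n) (nat ((int (Suc n) - i) + (int (Suc n) - j))))"
    proof -
      define s where "s = nat ((int (Suc n) - i) + (int (Suc n) - j))"
      have up: "?t (i - 2) (j - 1) = (-1)^n * int (dyck_prefixes n (Suc s))"
        using Suc.IH[of "i - 2" "j - 1"] Suc.prems by (simp add: s_def Suc_nat_eq_nat_zadd1 algebra_simps)
      show ?thesis
      proof (cases "i = int n + 1")
        \<comment> \<open>Here the usual predecessor at height \<open>s - 1\<close> exceeds the
          bound in \<open>a\<close>, and the third term takes its place. For \<open>s = 0\<close>
          that term exceeds the bound in \<open>b\<close>, so nothing enters from below 0.\<close>
        case i: True
        have "?t i (j - 1) = 0" using i by (simp add: zero)
        moreover have "?t (i - 1) j = (if s = 0 then 0 else (-1)^n * int (dyck_prefixes n (s - 1)))"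
        proof (cases "s = 0")
          case True
          then have "j > int n" using i by (simp add: s_def)
          then show ?thesis using True by (simp add: zero)
        next
          case False
          then have "nat ((int n - (i - 1)) + (int n - j)) = s - 1" "j \<le> int n"
            using i by (simp_all add: s_def nat_diff_distrib')
          then show ?thesis using Suc.IH[of "i - 1" j] i False by simp
        qed
        ultimately show ?thesis
          using i up unfolding s_def[symmetric] by (cases s) (simp_all add: distrib_left)
      next
        case False
        then obtain s' where s': "s = Suc s'"
          using Suc.prems by (cases s) (auto simp: s_def)
        have "nat ((int n - i) + (int n - (j - 1))) = s'"
          using s' unfolding s_def by linarith
        then have "?t i (j - 1) = (-1)^n * int (dyck_prefixes n s')"
          using Suc.IH[of i "j - 1"] Suc.prems False by simp
        then show ?thesis
          using False up unfolding s_def[symmetric] s' by (simp add: distrib_left)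
      qed
    qed
    finally show ?thesis .
  qed
qed

section \<open>Identification with the moments in the fraction field\<close>

lemma ind_nonzero: "ind_a \<noteq> 0" "ind_q \<noteq> 0"
  by (simp_all add: ind_a_def ind_q_def)

text \<open>The recursion runs through all parameters \<open>a q^r\<close>. The subtracted monomial
  contains \<open>a\<close>, so the constant coefficient is 1.\<close>

lemma ind_generic: "1 - ind_a * ind_q^r * ind_b * ind_c * ind_d * ind_q^k \<noteq> 0"
proof -
  have "1 - mono5 1 1 1 1 (r + k) \<noteq> 0"
  proof
    assume "1 - mono5 1 1 1 1 (r + k) = 0"
    then have "coeff5 (1 - mono5 1 1 1 1 (r + k) * 1) 0 0 0 0 0 = coeff5 0 0 0 0 0 0" by simp
    then show False unfolding coeff5_diff coeff5_mono5_mult by (simp add: coeff5_def)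
  qed
  then have "to_fract (1 - mono5 1 1 1 1 (r + k)) \<noteq> 0" unfolding to_fract_eq_0_iff .
  then show ?thesis by (simp add: to_fract_mono5 power_add mult_ac)
qed

lemma two_fract_nonzero: "(2 :: zpoly5 fract) \<noteq> 0"
proof -
  have "to_fract (1 + 1) = (1 + 1 :: zpoly5 fract)" by (simp only: to_fract_add to_fract_1)
  then have "to_fract 2 = (2 :: zpoly5 fract)" by (simp only: one_add_one)
  moreover have "to_fract (2 :: zpoly5) \<noteq> 0" unfolding to_fract_eq_0_iff by simp
  ultimately show ?thesis by simp
qed

text \<open>The recursion at \<open>a q^r\<close> calls the previous moment at \<open>a q^r\<close>
  and at \<open>a q^(r+1)\<close>, so the induction keeps \<open>r\<close> arbitrary.\<close>

lemma to_fract_dilate_aw_moment_poly: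
  "to_fract (dilate r (aw_moment_poly n)) = aw_scaled_moment (ind_a * ind_q^r) ind_b ind_c ind_d ind_q n"
proof (induction n arbitrary: r)
  case 0
  then show ?case by (simp add: dilate_hom aw_scaled_moment_0)
next
  case (Suc n)
  let ?a = "ind_a * ind_q^r"
  have "?a * to_fract (dilate r (aw_moment_poly (Suc n)))
      = to_fract (dilate r (mono5 1 0 0 0 0 * aw_moment_poly (Suc n)))"
    by (simp add: dilate_hom dilate_mono5 to_fract_mono5 del: aw_moment_poly.simps)
  also have "\<dots> = (1 + ?a^2) * (1 - ?a*ind_b*ind_c*ind_d*ind_q^n) * to_fract (dilate r (aw_moment_poly n))
      - (1 - ?a*ind_b) * (1 - ?a*ind_c) * (1 - ?a*ind_d) * to_fract (dilate (Suc r) (aw_moment_poly n))"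
    unfolding mono5_aw_moment_poly_Suc aw_step_def
    by (simp add: dilate_hom dilate_mono5 dilate_dilate to_fract_mono5 power_add power_mult power_mult_distrib mult_ac)
  also have "\<dots> = ?a * aw_scaled_moment ?a ind_b ind_c ind_d ind_q (Suc n)"
    using aw_scaled_moment_Suc[of ?a ind_q ind_b ind_c ind_d n] ind_nonzero two_fract_nonzero ind_generic[of r]
    by (simp add: Suc.IH mult_ac)
  finally show ?case using ind_nonzero by simp
qed

theorem theorem4p6:
  fixes n :: nat
  assumes "n \<ge> 1"
  shows "\<exists>F :: zpoly5.
     to_fract F = 2 ^ n * q_pochhammer (ind_a * ind_b * ind_c * ind_d) ind_q n
                    * aw_moment ind_a ind_b ind_c ind_d ind_q n \<and>
     of_int (coeff5 F (n-1) n n n (n choose 2)) = - Cat (of_nat (n + 1) / 2) \<and>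
     of_int (coeff5 F (n-1) (n-1) n n (n choose 2)) = Cat (of_nat (n + 2) / 2) - Cat (of_nat n / 2)"
proof (intro exI conjI)
  let ?F = "aw_moment_poly n"
  show "to_fract ?F = 2 ^ n * q_pochhammer (ind_a * ind_b * ind_c * ind_d) ind_q n
                    * aw_moment ind_a ind_b ind_c ind_d ind_q n"
    using to_fract_dilate_aw_moment_poly[of 0 n] by (simp add: dilate_0 aw_scaled_moment_def)
  \<comment> \<open>The height is 1, and one more down-step ends the path at 0.\<close>
  have "coeff5 ?F (n-1) n n n (n choose 2) = (-1)^n * int (dyck_prefixes (n + 1) 0)"
    using coeff5_int_aw_moment_poly_top[of "int (n-1)" n "int n"] assms
    unfolding coeff5_int_of_nat by (simp add: of_nat_diff)
  \<comment> \<open>For even \<open>n\<close> the count is 0 by parity, so the sign may be taken as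
    -1.\<close>
  also have "\<dots> = - int (dyck_prefixes (n + 1) 0)"
    using dyck_prefixes_odd[of "n + 1" 0] by (cases "even n") simp_all
  finally show "of_int (coeff5 ?F (n-1) n n n (n choose 2)) = - Cat (of_nat (n + 1) / 2)"
    unfolding Cat_half by simp
  have "coeff5 ?F (n-1) (n-1) n n (n choose 2) = (-1)^n * int (dyck_prefixes n 2)"
    using coeff5_int_aw_moment_poly_top[of "int (n-1)" n "int (n-1)"] assms
    unfolding coeff5_int_of_nat by (simp add: of_nat_diff)
  \<comment> \<open>The height is now 2, and the count is 0 for odd \<open>n\<close>, so the sign
    disappears.\<close>
  also have "\<dots> = int (dyck_prefixes n 2)"
    using dyck_prefixes_odd[of n 2] by (cases "even n") simp_all
  also have "\<dots> = int (dyck_prefixes (n + 2) 0) - int (dyck_prefixes n 0)"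
    using dyck_prefixes_2[of n] by linarith
  finally show "of_int (coeff5 ?F (n-1) (n-1) n n (n choose 2)) = Cat (of_nat (n + 2) / 2) - Cat (of_nat n / 2)"
    unfolding Cat_half by simp
qed

end
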